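(* Suppose that (1) $\theta\mapsto P_\theta(A)$ is measurable for every $A\in\mathcal{A}$, and (2) for all $\theta,\theta'\in\Theta$, $\theta\neq\theta'$ implies $P_\theta\neq P_{\theta'}$. Then there exists a measurable function $f:\mathcal{X}^\infty\to\Theta$ such that $f(x)=\theta$ for $\mu$-almost every $(x,\theta)$; that is, there is some $F\in\mathcal{A}^\infty\otimes\mathcal{B}$ with $\mu(F)=1$ such that $f(x)=\theta$ for all $(x,\theta)\in F$.
   Context: Let $\widehat{\mathcal{X}}$ and $\widehat\Theta$ be complete separable metric spaces. Let $\mathcal{X}\subseteq\widehat{\mathcal{X}}$ and $\Theta\subseteq\widehat\Theta$ be Borel measurable subsets, with induced Borel $\sigma$-algebras $\mathcal{A}$ and $\mathcal{B}$ respectively. For each $\theta\in\Theta$, let $P_\theta$ be a probability measure on $(\mathcal{X},\mathcal{A})$. Let $\Pi$ be a probability measure on $(\Theta,\mathcal{B})$. Let $\mathcal{X}^\infty=\mathcal{X}\times\mathcal{X}\times\cdots$ with product $\sigma$-algebra $\mathcal{A}^\infty$, and let $P_\theta^\infty$ be the infinite product probability measure on $(\mathcal{X}^\infty,\mathcal{A}^\infty)$ obtained from $P_\theta$. Let $\mu$ be the probability measure on $(\mathcal{X}^\infty\times\Theta,\mathcal{A}^\infty\otimes\mathcal{B})$ given by $\mu(E)=\int_\Theta P_\theta^\infty(E_\theta)\,d\Pi(\theta)$, where $E_\theta=\{x\in\mathcal{X}^\infty:(x,\theta)\in E\}$ (this is well-defined when condition (1) holds). *)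

theory Defs
  imports "HOL-Probability.Probability"
begin

definition seq_space :: "'a measure \<Rightarrow> (nat \<Rightarrow> 'a) measure" where
  "seq_space M = (\<Pi>\<^sub>M i\<in>(UNIV :: nat set). M)"

text \<open>
  The set function below takes the section of \<open>E\<close> at \<open>\<theta>\<close>, measures it with the infinite product
  of \<open>P \<theta>\<close> and integrates over the prior. Since \<^const>\<open>measure_of\<close> yields the zero measure when its
  set function is not countably additive, the lemmas \<open>emeasure_joint_measure\<close> and
  \<open>prob_space_joint_measure\<close> check that this does not happen when \<open>P\<close> is a measurable family of
  probability measures.
\<close>

definition joint_measure ::
    "'a measure \<Rightarrow> ('b \<Rightarrow> 'a measure) \<Rightarrow> 'b measure \<Rightarrow> ((nat \<Rightarrow> 'a) \<times> 'b) measure" where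
  "joint_measure A P prior =
     measure_of (space (seq_space A \<Otimes>\<^sub>M prior)) (sets (seq_space A \<Otimes>\<^sub>M prior))
       (\<lambda>E. \<integral>\<^sup>+ \<theta>. emeasure (seq_space (P \<theta>)) {x. (x, \<theta>) \<in> E} \<partial>prior)"

lemma space_joint_measure [simp]:
  "space (joint_measure A P prior) = space (seq_space A \<Otimes>\<^sub>M prior)"
  unfolding joint_measure_def by (simp add: sets.space_closed)

lemma sets_joint_measure [simp, measurable_cong]:
  "sets (joint_measure A P prior) = sets (seq_space A \<Otimes>\<^sub>M prior)"
  unfolding joint_measure_def by (simp add: sets.space_closed sets.sigma_sets_eq)

lemma measurable_seq_space_kernel:
  assumes prob: "\<And>\<theta>. \<theta> \<in> space B \<Longrightarrow> prob_space (P \<theta>)"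
    and sets_P: "\<And>\<theta>. \<theta> \<in> space B \<Longrightarrow> sets (P \<theta>) = sets A"
    and meas: "\<And>S. S \<in> sets A \<Longrightarrow> (\<lambda>\<theta>. measure (P \<theta>) S) \<in> borel_measurable B"
  shows "(\<lambda>\<theta>. seq_space (P \<theta>)) \<in> B \<rightarrow>\<^sub>M prob_algebra (seq_space A)"
proof (rule measurable_prob_algebra_generated)
  show "sets (seq_space A) = sigma_sets (\<Pi>\<^sub>E i\<in>UNIV. space A) (prod_algebra UNIV (\<lambda>_. A))"
    unfolding seq_space_def by (rule sets_PiM)
  show "Int_stable (prod_algebra (UNIV :: nat set) (\<lambda>_. A))"
    by (rule Int_stable_prod_algebra)
  show "prod_algebra (UNIV :: nat set) (\<lambda>_. A) \<subseteq> Pow (\<Pi>\<^sub>E i\<in>UNIV. space A)"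
    by (rule prod_algebra_sets_into_space)
  show "prob_space (seq_space (P \<theta>))" if "\<theta> \<in> space B" for \<theta>
    unfolding seq_space_def using prob[OF that] by (intro prob_space_PiM)
  show "sets (seq_space (P \<theta>)) = sets (seq_space A)" if "\<theta> \<in> space B" for \<theta>
    unfolding seq_space_def using sets_P[OF that] by (intro sets_PiM_cong) auto
next
  fix E assume "E \<in> prod_algebra (UNIV :: nat set) (\<lambda>_. A)"
  then obtain J F where E: "E = prod_emb UNIV (\<lambda>_. A) J (\<Pi>\<^sub>E j\<in>J. F j)"
    and J: "finite J" and F: "\<And>i. i \<in> J \<Longrightarrow> F i \<in> sets A"
    by (rule prod_algebraE) auto
  have "emeasure (seq_space (P \<theta>)) E = (\<Prod>i\<in>J. ennreal (measure (P \<theta>) (F i)))"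
    if \<theta>: "\<theta> \<in> space B" for \<theta>
  proof -
    interpret prob_space "P \<theta>" by (rule prob[OF \<theta>])
    have "E = prod_emb UNIV (\<lambda>_. P \<theta>) J (\<Pi>\<^sub>E j\<in>J. F j)"
      using sets_eq_imp_space_eq[OF sets_P[OF \<theta>]] by (simp add: E prod_emb_def)
    then show ?thesis
      unfolding seq_space_def
      using J F by (simp add: emeasure_PiM_emb prob[OF \<theta>] sets_P[OF \<theta>] emeasure_eq_measure)
  qed
  moreover have "(\<lambda>\<theta>. \<Prod>i\<in>J. ennreal (measure (P \<theta>) (F i))) \<in> borel_measurable B"
    by (intro borel_measurable_prod_ennreal measurable_compose[OF _ measurable_ennreal] meas F)
  ultimately show "(\<lambda>\<theta>. emeasure (seq_space (P \<theta>)) E) \<in> borel_measurable B"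
    by (simp cong: measurable_cong)
qed

lemma emeasure_joint_measure:
  assumes prob: "\<And>\<theta>. \<theta> \<in> space prior \<Longrightarrow> prob_space (P \<theta>)"
    and sets_P: "\<And>\<theta>. \<theta> \<in> space prior \<Longrightarrow> sets (P \<theta>) = sets A"
    and meas: "\<And>S. S \<in> sets A \<Longrightarrow> (\<lambda>\<theta>. measure (P \<theta>) S) \<in> borel_measurable prior"
    and E: "E \<in> sets (seq_space A \<Otimes>\<^sub>M prior)"
  shows "emeasure (joint_measure A P prior) E =
    (\<integral>\<^sup>+ \<theta>. emeasure (seq_space (P \<theta>)) {x. (x, \<theta>) \<in> E} \<partial>prior)"
proof (rule emeasure_measure_of[OF joint_measure_def])
  let ?f = "\<lambda>E \<theta>. emeasure (seq_space (P \<theta>)) {x. (x, \<theta>) \<in> E}"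
  have kernel: "(\<lambda>\<theta>. seq_space (P \<theta>)) \<in> prior \<rightarrow>\<^sub>M subprob_algebra (seq_space A)"
    using measurable_seq_space_kernel[OF prob sets_P meas] by (rule measurable_prob_algebraD)
  have sections: "{x. (x, \<theta>) \<in> E} \<in> sets (seq_space (P \<theta>))"
    if "E \<in> sets (seq_space A \<Otimes>\<^sub>M prior)" "\<theta> \<in> space prior" for E \<theta>
    using sets_Pair2[OF that(1), of \<theta>] sets_kernel[OF kernel that(2)] by (simp add: vimage_def)
  have f_meas: "?f E \<in> borel_measurable prior" if E: "E \<in> sets (seq_space A \<Otimes>\<^sub>M prior)" for E
  proof (rule emeasure_measurable_subprob_algebra2[OF _ kernel])
    have "(SIGMA \<theta>:space prior. {x. (x, \<theta>) \<in> E}) =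
        (\<lambda>(\<theta>, x). (x, \<theta>)) -` E \<inter> space (prior \<Otimes>\<^sub>M seq_space A)"
      using sets.sets_into_space[OF E] by (auto simp: space_pair_measure)
    also have "\<dots> \<in> sets (prior \<Otimes>\<^sub>M seq_space A)"
      by (rule measurable_sets[OF measurable_pair_swap' E])
    finally show "(SIGMA \<theta>:space prior. {x. (x, \<theta>) \<in> E}) \<in> sets (prior \<Otimes>\<^sub>M seq_space A)" .
  qed
  show "sets (seq_space A \<Otimes>\<^sub>M prior) \<subseteq> Pow (space (seq_space A \<Otimes>\<^sub>M prior))"
    by (rule sets.space_closed)
  show "E \<in> sets (joint_measure A P prior)"
    using E by simp
  show "positive (sets (joint_measure A P prior)) (\<lambda>E. \<integral>\<^sup>+ \<theta>. ?f E \<theta> \<partial>prior)"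
    by (simp add: positive_def)
  show "countably_additive (sets (joint_measure A P prior)) (\<lambda>E. \<integral>\<^sup>+ \<theta>. ?f E \<theta> \<partial>prior)"
  proof (rule countably_additiveI)
    fix D :: "nat \<Rightarrow> _"
    assume "range D \<subseteq> sets (joint_measure A P prior)" and disj: "disjoint_family D"
    then have D: "D i \<in> sets (seq_space A \<Otimes>\<^sub>M prior)" for i
      by auto
    have "(\<Sum>i. \<integral>\<^sup>+ \<theta>. ?f (D i) \<theta> \<partial>prior) = (\<integral>\<^sup>+ \<theta>. (\<Sum>i. ?f (D i) \<theta>) \<partial>prior)"
      by (rule nn_integral_suminf[symmetric]) (rule f_meas[OF D])
    also have "\<dots> = (\<integral>\<^sup>+ \<theta>. ?f (\<Union>i. D i) \<theta> \<partial>prior)"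
    proof (rule nn_integral_cong)
      fix \<theta> assume \<theta>: "\<theta> \<in> space prior"
      have "(\<Sum>i. ?f (D i) \<theta>) = emeasure (seq_space (P \<theta>)) (\<Union>i. {x. (x, \<theta>) \<in> D i})"
        using sections[OF D \<theta>] disj
        by (intro suminf_emeasure) (auto simp: disjoint_family_on_def)
      also have "(\<Union>i. {x. (x, \<theta>) \<in> D i}) = {x. (x, \<theta>) \<in> (\<Union>i. D i)}"
        by auto
      finally show "(\<Sum>i. ?f (D i) \<theta>) = ?f (\<Union>i. D i) \<theta>" .
    qed
    finally show "(\<Sum>i. \<integral>\<^sup>+ \<theta>. ?f (D i) \<theta> \<partial>prior) = (\<integral>\<^sup>+ \<theta>. ?f (\<Union>i. D i) \<theta> \<partial>prior)" .
  qed
qed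

lemma prob_space_joint_measure:
  assumes prior: "prob_space prior"
    and prob: "\<And>\<theta>. \<theta> \<in> space prior \<Longrightarrow> prob_space (P \<theta>)"
    and sets_P: "\<And>\<theta>. \<theta> \<in> space prior \<Longrightarrow> sets (P \<theta>) = sets A"
    and meas: "\<And>S. S \<in> sets A \<Longrightarrow> (\<lambda>\<theta>. measure (P \<theta>) S) \<in> borel_measurable prior"
  shows "prob_space (joint_measure A P prior)"
proof
  let ?\<Omega> = "space (seq_space A \<Otimes>\<^sub>M prior)"
  have "emeasure (joint_measure A P prior) ?\<Omega> =
      (\<integral>\<^sup>+ \<theta>. emeasure (seq_space (P \<theta>)) {x. (x, \<theta>) \<in> ?\<Omega>} \<partial>prior)"
    by (rule emeasure_joint_measure[OF prob sets_P meas]) auto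
  also have "\<dots> = (\<integral>\<^sup>+ \<theta>. 1 \<partial>prior)"
  proof (rule nn_integral_cong)
    fix \<theta> assume \<theta>: "\<theta> \<in> space prior"
    have "{x. (x, \<theta>) \<in> ?\<Omega>} = space (seq_space (P \<theta>))"
      using \<theta> sets_eq_imp_space_eq[OF sets_P[OF \<theta>]]
      by (simp add: space_pair_measure seq_space_def space_PiM)
    moreover have "prob_space (seq_space (P \<theta>))"
      unfolding seq_space_def using prob[OF \<theta>] by (intro prob_space_PiM)
    ultimately show "emeasure (seq_space (P \<theta>)) {x. (x, \<theta>) \<in> ?\<Omega>} = 1"
      by (simp add: prob_space.emeasure_space_1)
  qed
  also have "\<dots> = 1"
    by (simp add: prob_space.emeasure_space_1[OF prior])
  finally show "emeasure (joint_measure A P prior) (space (joint_measure A P prior)) = 1"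
    by simp
qed

end

theory Submission
  imports Defs
begin

text \<open>
  This is Doob's theorem on the existence of a consistent estimator. The data reveal the parameter
  through empirical frequencies.

  Fix countably many sets \<open>C k\<close> whose measures determine any probability measure on \<open>X\<close>
  (\<open>countable_measure_determining_class\<close>), and encode the parameter as the real sequence
  \<open>g \<theta> = (\<lambda>k. P \<theta> (C k))\<close>. Measurability of the family \<open>P\<close> makes \<open>g\<close> measurable, and
  identifiability makes it injective on \<open>\<Theta>\<close>. Let \<open>h x k\<close> be the limit of the empirical frequencies of
  \<open>C k\<close> along the sample \<open>x\<close>. By the strong law of large numbers (\<open>strong_law_event\<close>), \<open>h x = g \<theta>\<close> for
  almost every \<open>x\<close> drawn from \<open>P \<theta>\<close>. The estimator is therefore to be \<open>g\<close> inverted at \<open>h x\<close>.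

  The one difficulty is that the inverse of a measurable injection must be measurable. Since a set of
  parameters of prior probability zero may be neglected, inner regularity of the prior is enough: on
  compact sets that exhaust \<open>\<Theta>\<close> up to a null set, \<open>g\<close> is continuous, and there its inverse is Borel
  (\<open>injective_measurable_ae_inverse\<close>). Integrating over the prior shows that the estimator is correct
  almost everywhere under the joint law.
\<close>

section \<open>The strong law of large numbers for empirical frequencies\<close>

text \<open>
  Hoeffding's inequality bounds the probability that the empirical frequency of \<open>A\<close> after \<open>n\<close> draws
  is off by at least \<open>\<epsilon>\<close> by the geometric sequence \<open>2 * exp (- 2 * \<epsilon>\<^sup>2) ^ n\<close>. It is summable, so by
  Borel-Cantelli almost every sequence of draws has only finitely many such deviations. Letting
  \<open>\<epsilon>\<close> run through \<open>1 / Suc m\<close> keeps the exceptional set a countable union of null sets.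
\<close>

lemma (in prob_space) strong_law_event:
  assumes A: "A \<in> events"
  shows "AE x in seq_space M. (\<lambda>n. (\<Sum>i<n. indicator A (x i)) / real n) \<longlonglongrightarrow> prob A"
proof -
  define Y :: "nat \<Rightarrow> (nat \<Rightarrow> 'a) \<Rightarrow> real" where "Y i x = indicator A (x i)" for i x
  interpret S: prob_space "seq_space M"
    unfolding seq_space_def by (intro prob_space_PiM prob_space_axioms)
  have coord [measurable]: "(\<lambda>x. x i) \<in> seq_space M \<rightarrow>\<^sub>M M" for i
    unfolding seq_space_def by measurable
  have coord_distr: "distr (seq_space M) M (\<lambda>x. x i) = M" for i
    unfolding seq_space_def by (rule distr_PiM_component) (auto intro: prob_space_axioms)
  have Y_meas [measurable]: "Y i \<in> borel_measurable (seq_space M)" for i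
    using A unfolding Y_def by measurable
  have "S.indep_vars (\<lambda>_. M) (\<lambda>i x. x i) UNIV"
    by (subst S.indep_vars_iff_distr_eq_PiM') (simp_all add: coord_distr, simp add: seq_space_def distr_id2 restrict_UNIV)
  then have Y_indep: "S.indep_vars (\<lambda>_. borel) Y UNIV"
    unfolding Y_def by (rule S.indep_vars_compose2) (use A in measurable)
  have Y_distr: "distr (seq_space M) borel (Y i) = distr M borel (indicator A)" for i
  proof -
    have "distr M borel (indicator A :: 'a \<Rightarrow> real)
        = distr (distr (seq_space M) M (\<lambda>x. x i)) borel (indicator A)"
      by (simp only: coord_distr)
    also have "\<dots> = distr (seq_space M) borel (Y i)"
      using A by (subst distr_distr) (auto simp: Y_def[abs_def] comp_def)
    finally show ?thesis ..
  qed
  have Y_mean: "S.expectation (Y 0) = prob A"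
  proof -
    have "S.expectation (Y 0) = integral\<^sup>L (distr (seq_space M) borel (Y 0)) (\<lambda>y. y)"
      by (simp add: integral_distr)
    also have "\<dots> = prob A"
      unfolding Y_distr using A by (simp add: integral_distr)
    finally show ?thesis .
  qed
  define D where
    "D \<epsilon> n = {x \<in> space (seq_space M). \<epsilon> \<le> \<bar>(\<Sum>i<n. Y i x) / real n - prob A\<bar>}" for \<epsilon> n
  have D_meas [measurable]: "D \<epsilon> n \<in> S.events" for \<epsilon> n
    unfolding D_def by measurable
  have D_bound: "S.prob (D \<epsilon> n) \<le> 2 * exp (- 2 * \<epsilon>\<^sup>2) ^ n" if "0 < \<epsilon>" "0 < n" for \<epsilon> n
  proof -
    interpret H: Hoeffding_ineq_iid "seq_space M" "{..<n}" Y "Y 0" 0 1 "prob A"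
    proof unfold_locales
      show "S.indep_vars (\<lambda>_. borel) Y {..<n}"
        using Y_indep by (rule S.indep_vars_subset) auto
      show "distr (seq_space M) borel (Y i) = distr (seq_space M) borel (Y 0)" for i
        by (simp add: Y_distr)
      show "AE x in seq_space M. Y 0 x \<in> {0..1}"
        by (simp add: Y_def)
    qed (simp_all add: Y_mean)
    have "S.prob (D \<epsilon> n) \<le> 2 * exp (- 2 * n * \<epsilon>\<^sup>2)"
      using H.Hoeffding_ineq_abs_ge'[of \<epsilon>] that by (simp add: D_def lessThan_empty_iff)
    also have "exp (- 2 * n * \<epsilon>\<^sup>2) = exp (- 2 * \<epsilon>\<^sup>2) ^ n"
      by (simp flip: exp_of_nat_mult add: algebra_simps)
    finally show ?thesis .
  qed
  have D_eventually: "AE x in seq_space M. \<forall>\<^sub>F n in sequentially. x \<in> space (seq_space M) - D \<epsilon> n"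
    if "0 < \<epsilon>" for \<epsilon>
  proof (rule borel_cantelli_AE1)
    have "summable (\<lambda>n. 2 * exp (- 2 * \<epsilon>\<^sup>2) ^ n)"
      using that by (intro summable_mult summable_geometric) simp
    then show "summable (\<lambda>n. S.prob (D \<epsilon> n))"
    proof (rule summable_comparison_test')
      show "norm (S.prob (D \<epsilon> n)) \<le> 2 * exp (- 2 * \<epsilon>\<^sup>2) ^ n" if "1 \<le> n" for n
        using D_bound[OF \<open>0 < \<epsilon>\<close>, of n] that by simp
    qed
  qed (auto simp: S.emeasure_eq_measure)
  have "AE x in seq_space M. \<forall>m. \<forall>\<^sub>F n in sequentially. x \<in> space (seq_space M) - D (1 / Suc m) n"
    unfolding AE_all_countable by (intro allI D_eventually) simp
  then show ?thesis
  proof (rule AE_mp, intro AE_I2 impI tendstoI)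
    fix x and \<epsilon> :: real
    assume close: "\<forall>m. \<forall>\<^sub>F n in sequentially. x \<in> space (seq_space M) - D (1 / Suc m) n" and "0 < \<epsilon>"
    obtain m where m: "1 / Suc m < \<epsilon>"
      using nat_approx_posE[OF \<open>0 < \<epsilon>\<close>] by blast
    show "\<forall>\<^sub>F n in sequentially. dist ((\<Sum>i<n. indicator A (x i)) / real n) (prob A) < \<epsilon>"
      using close[rule_format, of m]
      by eventually_elim (use m in \<open>auto simp: D_def Y_def dist_real_def\<close>)
  qed
qed

section \<open>Injective measurable maps have a Borel almost-everywhere inverse\<close>

lemma compact_approximation:
  fixes M :: "'a :: polish_space measure"
  assumes "finite_measure M" and sets_M: "sets M = sets borel" and S: "S \<in> sets borel" and "0 < \<delta>"
  obtains L where "compact L" "L \<subseteq> S" "measure M (S - L) \<le> \<delta>"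
proof -
  interpret finite_measure M by fact
  have inner: "emeasure M S = (SUP K \<in> {K. K \<subseteq> S \<and> compact K}. emeasure M K)"
    by (rule inner_regular[OF sets_M _ S]) simp
  have "\<exists>K \<in> {K. K \<subseteq> S \<and> compact K}. emeasure M S < emeasure M K + ennreal \<delta>"
    by (rule SUP_approx_ennreal[OF \<open>0 < \<delta>\<close> _ inner]) auto
  then obtain K where K: "K \<subseteq> S" "compact K" "emeasure M S < emeasure M K + ennreal \<delta>"
    by blast
  then have "K \<in> sets M"
    using sets_M by (simp add: compact_imp_closed)
  then have "measure M (S - K) = measure M S - measure M K"
    using K S sets_M by (intro finite_measure_Diff) auto
  moreover have "measure M S < measure M K + \<delta>"
    using K(3) \<open>0 < \<delta>\<close> by (simp add: emeasure_eq_measure ennreal_less_iff flip: ennreal_plus)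
  ultimately show thesis
    using that K by simp
qed

text \<open>
  This is Lusin's theorem, with compact sets. For each member \<open>U n\<close> of a countable basis of the
  target, the two pieces of \<open>B\<close> on which \<open>g\<close> lies inside and outside \<open>U n\<close> are exhausted by compact
  sets \<open>L n\<close> and \<open>L' n\<close> up to a total loss of \<open>\<epsilon> / 2 ^ Suc n\<close>. On the intersection \<open>K\<close> of all the
  sets \<open>L n \<union> L' n\<close>, being mapped into \<open>U n\<close> is the same as lying in the open set \<open>- L' n\<close>, so \<open>g\<close>
  is continuous there, and the losses add up to at most \<open>\<epsilon>\<close>.
\<close>

lemma lusin_compact:
  fixes M :: "'a :: polish_space measure"
    and g :: "'a \<Rightarrow> 'b :: second_countable_topology"
  assumes fin: "finite_measure M" and sets_M: "sets M = sets borel"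
    and g: "g \<in> borel_measurable borel" and B: "B \<in> sets borel" and "0 < \<epsilon>"
  obtains K where "compact K" "K \<subseteq> B" "continuous_on K g" "measure M (B - K) \<le> \<epsilon>"
proof -
  interpret finite_measure M by fact
  obtain \<U> :: "'b set set" where \<U>: "countable \<U>" "topological_basis \<U>"
    using ex_countable_basis by blast
  have "\<U> \<noteq> {}"
    using topological_basisE[OF \<U>(2) open_UNIV UNIV_I] by blast
  then obtain U :: "nat \<Rightarrow> 'b set" where U: "range U = \<U>"
    using \<U>(1) by (metis range_from_nat_into)
  have U_open: "open (U n)" for n
    using U \<U>(2) topological_basis_open by blast
  have "\<exists>L L'. compact L \<and> compact L' \<and> L \<subseteq> B \<inter> g -` U n \<and> L' \<subseteq> B - g -` U n \<and>
      measure M (B - (L \<union> L')) \<le> \<epsilon> * (1/2) ^ Suc n" for n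
  proof -
    have gU: "g -` U n \<in> sets borel"
      using measurable_sets[OF g, of "U n"] U_open by simp
    have \<delta>: "0 < \<epsilon> * (1/2) ^ Suc n / 2"
      using \<open>0 < \<epsilon>\<close> by simp
    obtain L where L: "compact L" "L \<subseteq> B \<inter> g -` U n"
        "measure M (B \<inter> g -` U n - L) \<le> \<epsilon> * (1/2) ^ Suc n / 2"
      using compact_approximation[OF fin sets_M _ \<delta>, of "B \<inter> g -` U n"] B gU by blast
    obtain L' where L': "compact L'" "L' \<subseteq> B - g -` U n"
        "measure M (B - g -` U n - L') \<le> \<epsilon> * (1/2) ^ Suc n / 2"
      using compact_approximation[OF fin sets_M _ \<delta>, of "B - g -` U n"] B gU by blast
    have [measurable]: "L \<in> sets M" "L' \<in> sets M" "B \<in> sets M" "g -` U n \<in> sets M"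
      using L(1) L'(1) B gU sets_M by (auto intro: borel_compact)
    have "measure M (B - (L \<union> L')) \<le>
        measure M ((B \<inter> g -` U n - L) \<union> (B - g -` U n - L'))"
      by (rule finite_measure_mono) auto
    also have "\<dots> \<le> measure M (B \<inter> g -` U n - L) + measure M (B - g -` U n - L')"
      by (intro measure_Un_le) auto
    also have "\<dots> \<le> \<epsilon> * (1/2) ^ Suc n"
      using L(3) L'(3) by simp
    finally show ?thesis
      using L L' by blast
  qed
  then obtain L L' where L: "\<And>n. compact (L n)" "\<And>n. compact (L' n)"
      "\<And>n. L n \<subseteq> B \<inter> g -` U n" "\<And>n. L' n \<subseteq> B - g -` U n"
      "\<And>n. measure M (B - (L n \<union> L' n)) \<le> \<epsilon> * (1/2) ^ Suc n"
    by metis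
  define K where "K = (\<Inter>n. L n \<union> L' n)"
  have "compact K"
  proof -
    have "closed K"
      unfolding K_def using L(1,2) by (intro closed_INT ballI compact_imp_closed compact_Un)
    moreover have "K = (L 0 \<union> L' 0) \<inter> K"
      unfolding K_def by blast
    ultimately show ?thesis
      using L(1,2) by (metis compact_Int_closed compact_Un)
  qed
  moreover have "K \<subseteq> B"
    using L(3,4) unfolding K_def by blast
  moreover have "continuous_on K g"
    unfolding continuous_on_topological
  proof (intro ballI allI impI)
    fix x V assume x: "x \<in> K" and V: "open V" "g x \<in> V"
    obtain n where n: "g x \<in> U n" "U n \<subseteq> V"
      using topological_basisE[OF \<U>(2) V] U by (metis rangeE)
    have "open (- L' n)"
      using L(2) by (simp add: compact_imp_closed open_Compl)
    moreover have "x \<in> - L' n"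
      using n(1) L(4)[of n] by auto
    moreover have "g y \<in> V" if "y \<in> K" "y \<in> - L' n" for y
      using that L(3)[of n] n(2) unfolding K_def by blast
    ultimately show "\<exists>A. open A \<and> x \<in> A \<and> (\<forall>y\<in>K. y \<in> A \<longrightarrow> g y \<in> V)"
      by blast
  qed
  moreover have "measure M (B - K) \<le> \<epsilon>"
  proof -
    have geometric: "(\<lambda>n. \<epsilon> * (1/2) ^ Suc n) sums \<epsilon>"
      using sums_mult[OF power_half_series, of \<epsilon>] by simp
    have summ: "summable (\<lambda>n. measure M (B - (L n \<union> L' n)))"
      using L(5) by (intro summable_comparison_test'[OF sums_summable[OF geometric]]) auto
    have "B - (L n \<union> L' n) \<in> sets M" for n
      unfolding sets_M by (intro sets.Diff sets.Un borel_compact L B)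
    then have "measure M (\<Union>n. B - (L n \<union> L' n)) \<le> (\<Sum>n. measure M (B - (L n \<union> L' n)))"
      using summ by (intro finite_measure_subadditive_countably) auto
    also have "\<dots> \<le> \<epsilon>"
      using suminf_le[OF L(5) summ sums_summable[OF geometric]] sums_unique[OF geometric] by simp
    also have "(\<Union>n. B - (L n \<union> L' n)) = B - K"
      unfolding K_def by auto
    finally show ?thesis .
  qed
  ultimately show thesis
    by (rule that)
qed

text \<open>
  The Lusin-Souslin theorem says that an injective Borel map between Polish spaces has a Borel image
  and a Borel inverse. Up to a null set, compactness gives as much with far less effort. By Lusin's
  theorem, \<open>B\<close> is exhausted up to a null set by the union \<open>S\<close> of countably many compact sets \<open>K n\<close> on
  each of which \<open>g\<close> is continuous. Then for closed \<open>C\<close> the image of \<open>S \<inter> C\<close> is a countable union of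
  compact sets, hence Borel. As \<open>g\<close> is injective, this image is the preimage of \<open>C\<close> under the
  inverse of \<open>g\<close> on \<open>S\<close>. The inverse extends to the whole target by a constant value in \<open>B\<close>.
\<close>

lemma injective_measurable_ae_inverse:
  fixes M :: "'a :: polish_space measure"
    and g :: "'a \<Rightarrow> 'b :: {second_countable_topology, t2_space}"
  assumes fin: "finite_measure M" and sets_M: "sets M = sets borel"
    and g: "g \<in> borel_measurable borel" and B: "B \<in> sets borel" "B \<noteq> {}" and inj: "inj_on g B"
  obtains S r where "S \<in> sets borel" "S \<subseteq> B" "measure M (B - S) = 0"
    "r \<in> borel_measurable borel" "range r \<subseteq> B" "\<And>\<theta>. \<theta> \<in> S \<Longrightarrow> r (g \<theta>) = \<theta>"
proof -
  interpret finite_measure M by fact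
  have "\<exists>K. compact K \<and> K \<subseteq> B \<and> continuous_on K g \<and> measure M (B - K) \<le> 1 / Suc n" for n
    by (rule lusin_compact[OF fin sets_M g B(1), of "1 / Suc n"]) auto
  then obtain K where K: "\<And>n. compact (K n)" "\<And>n. K n \<subseteq> B" "\<And>n. continuous_on (K n) g"
      "\<And>n. measure M (B - K n) \<le> 1 / Suc n"
    by metis
  define S where "S = (\<Union>n. K n)"
  obtain c where c: "c \<in> B"
    using B(2) by blast
  define r where "r y = (if y \<in> g ` S then inv_into S g y else c)" for y
  have S_borel: "S \<in> sets borel"
    unfolding S_def using K(1) by (intro sets.countable_UN'') (auto intro: borel_compact)
  have SB: "S \<subseteq> B"
    using K(2) unfolding S_def by blast
  have inj_S: "inj_on g S"
    using inj SB by (rule inj_on_subset)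
  have r_g: "r (g \<theta>) = \<theta>" if "\<theta> \<in> S" for \<theta>
    using that inj_S by (simp add: r_def)
  have image_borel: "g ` (S \<inter> C) \<in> sets borel" if "closed C" for C
  proof -
    have "compact (g ` (K n \<inter> C))" for n
      using K(1,3) that
      by (intro compact_continuous_image continuous_on_subset[OF K(3)] compact_Int_closed) auto
    then have "g ` (K n \<inter> C) \<in> sets borel" for n
      by (rule borel_compact)
    then have "(\<Union>n. g ` (K n \<inter> C)) \<in> sets borel"
      by blast
    also have "(\<Union>n. g ` (K n \<inter> C)) = g ` (S \<inter> C)"
      unfolding S_def by blast
    finally show ?thesis .
  qed
  have "r \<in> borel_measurable borel"
    unfolding borel_eq_closed[where 'a = 'a]
  proof (rule measurable_measure_of)
    fix C :: "'a set" assume "C \<in> Collect closed"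
    then have C: "closed C" by simp
    have "r -` C = g ` (S \<inter> C) \<union> (if c \<in> C then - g ` S else {})"
    proof (intro set_eqI)
      fix y
      show "y \<in> r -` C \<longleftrightarrow> y \<in> g ` (S \<inter> C) \<union> (if c \<in> C then - g ` S else {})"
      proof (cases "y \<in> g ` S")
        case True
        then obtain \<theta> where \<theta>: "\<theta> \<in> S" "y = g \<theta>" by blast
        then have "g \<theta> \<in> g ` (S \<inter> C) \<longleftrightarrow> \<theta> \<in> C"
          using inj_S by (auto dest: inj_onD)
        then show ?thesis
          using \<theta> r_g by auto
      qed (auto simp: r_def)
    qed
    moreover have "- g ` S \<in> sets borel"
      using image_borel[of UNIV] by auto
    ultimately show "r -` C \<inter> space borel \<in> sets borel"
      using image_borel[OF C] by auto
  qed auto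
  moreover have "measure M (B - S) = 0"
  proof -
    have "measure M (B - S) \<le> 1 / Suc n" for n
    proof -
      have "measure M (B - S) \<le> measure M (B - K n)"
        using B(1) K(1) S_borel sets_M
        by (intro finite_measure_mono) (auto simp: S_def intro: borel_compact)
      then show ?thesis
        using K(4)[of n] by simp
    qed
    then have "\<not> 0 < measure M (B - S)"
      by (metis nat_approx_posE not_less)
    then show ?thesis
      by (simp add: zero_less_measure_iff)
  qed
  moreover have "range r \<subseteq> B"
    using c SB by (auto simp: r_def) (metis image_eqI inv_into_into subsetD)
  ultimately show thesis
    using that S_borel SB r_g by blast
qed

section \<open>Countable measure-determining classes\<close>

text \<open>
  The finite intersections of a countable basis, traced on \<open>X\<close>, form a countable generator that is
  closed under intersection, so that a finite measure is determined by its values on it. The empty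
  intersection contributes \<open>X\<close> itself and thereby the total mass.
\<close>

lemma countable_measure_determining_class:
  fixes X :: "'a :: second_countable_topology set"
  shows "\<exists>C :: nat \<Rightarrow> 'a set. range C \<subseteq> sets (restrict_space borel X) \<and>
    (\<forall>M N. finite_measure M \<longrightarrow> sets M = sets (restrict_space borel X) \<longrightarrow>
      sets N = sets (restrict_space borel X) \<longrightarrow> (\<forall>k. emeasure M (C k) = emeasure N (C k)) \<longrightarrow> M = N)"
proof -
  obtain \<U> :: "'a set set" where \<U>: "countable \<U>" "topological_basis \<U>"
    using ex_countable_basis by blast
  define \<C> where "\<C> = (\<lambda>F. X \<inter> \<Inter>F) ` {F. finite F \<and> F \<subseteq> \<U>}"
  have countable: "countable \<C>"
    unfolding \<C>_def using \<U>(1) by (intro countable_image countable_Collect_finite_subset)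
  have "X \<in> \<C>"
    unfolding \<C>_def by (rule image_eqI[of _ _ "{}"]) auto
  then obtain C :: "nat \<Rightarrow> 'a set" where C: "range C = \<C>"
    using countable by (metis range_from_nat_into empty_iff)
  have "Int_stable \<C>"
  proof (rule Int_stableI)
    fix a b assume "a \<in> \<C>" "b \<in> \<C>"
    then obtain F G where "finite F" "F \<subseteq> \<U>" "a = X \<inter> \<Inter>F" "finite G" "G \<subseteq> \<U>" "b = X \<inter> \<Inter>G"
      unfolding \<C>_def by auto
    then show "a \<inter> b \<in> \<C>"
      unfolding \<C>_def by (intro image_eqI[of _ _ "F \<union> G"]) auto
  qed
  have \<C>_sub: "\<C> \<subseteq> Pow X"
    unfolding \<C>_def by auto
  have "open (\<Inter>F)" if "finite F" "F \<subseteq> \<U>" for F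
    using that \<U>(2) topological_basis_open by (intro open_Inter) auto
  then have \<C>_sets: "\<C> \<subseteq> sets (restrict_space borel X)"
    unfolding \<C>_def by (auto simp: sets_restrict_space)
  have generated: "sets (restrict_space borel X) = sigma_sets X \<C>"
  proof (rule antisym)
    show "sigma_sets X \<C> \<subseteq> sets (restrict_space borel X)"
      using sets.sigma_sets_subset[OF \<C>_sets] by (simp add: space_restrict_space)
    have "X \<inter> Y \<in> sigma_sets X \<C>" if "Y \<in> sigma_sets UNIV \<U>" for Y
      using that
    proof induction
      case (Basic a)
      then have "X \<inter> a \<in> \<C>"
        unfolding \<C>_def by (intro image_eqI[of _ _ "{a}"]) auto
      then show ?case ..
    next
      case (Compl a)
      then have "X - X \<inter> a \<in> sigma_sets X \<C>"
        by (intro sigma_sets.Compl)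
      also have "X - X \<inter> a = X \<inter> (UNIV - a)"
        by auto
      finally show ?case .
    next
      case (Union a)
      then have "(\<Union>i. X \<inter> a i) \<in> sigma_sets X \<C>"
        by (intro sigma_sets.Union)
      then show ?case
        by simp
    qed (simp add: sigma_sets.Empty)
    moreover have "sets (borel :: 'a measure) = sigma_sets UNIV \<U>"
      by (subst borel_eq_countable_basis[OF \<U>]) simp
    ultimately show "sets (restrict_space borel X) \<subseteq> sigma_sets X \<C>"
      by (auto simp: sets_restrict_space)
  qed
  show ?thesis
  proof (intro exI[of _ C] conjI allI impI)
    show "range C \<subseteq> sets (restrict_space borel X)"
      using C \<C>_sets by simp
  next
    fix M N :: "'a measure"
    assume "finite_measure M" and sets: "sets M = sets (restrict_space borel X)"
      "sets N = sets (restrict_space borel X)" and eq: "\<forall>k. emeasure M (C k) = emeasure N (C k)"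
    interpret finite_measure M by fact
    show "M = N"
    proof (rule measure_eqI_generator_eq[OF \<open>Int_stable \<C>\<close> \<C>_sub])
      show "range (\<lambda>_ :: nat. X) \<subseteq> \<C>"
        using \<open>X \<in> \<C>\<close> by auto
      show "emeasure M Y = emeasure N Y" if "Y \<in> \<C>" for Y
        using that eq C by (metis rangeE)
    qed (simp_all add: sets generated)
  qed
qed

section \<open>Consistent estimation of the parameter\<close>

theorem theorem4p1:
  fixes X :: "'a :: polish_space set"
    and \<Theta> :: "'b :: polish_space set"
    and P :: "'b \<Rightarrow> 'a measure"
    and prior :: "'b measure"
  assumes X_borel: "X \<in> sets borel"
    and \<Theta>_borel: "\<Theta> \<in> sets borel"
    and prob_P: "\<And>\<theta>. \<theta> \<in> \<Theta> \<Longrightarrow> prob_space (P \<theta>)"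
    and sets_P: "\<And>\<theta>. \<theta> \<in> \<Theta> \<Longrightarrow> sets (P \<theta>) = sets (restrict_space borel X)"
    and prob_prior: "prob_space prior"
    and sets_prior: "sets prior = sets (restrict_space borel \<Theta>)"
    and measurable_P: "\<And>A. A \<in> sets (restrict_space borel X) \<Longrightarrow>
      (\<lambda>\<theta>. measure (P \<theta>) A) \<in> borel_measurable (restrict_space borel \<Theta>)"
    and identifiable: "\<And>\<theta> \<theta>'. \<theta> \<in> \<Theta> \<Longrightarrow> \<theta>' \<in> \<Theta> \<Longrightarrow> \<theta> \<noteq> \<theta>' \<Longrightarrow> P \<theta> \<noteq> P \<theta>'"
  shows "\<exists>f \<in> seq_space (restrict_space borel X) \<rightarrow>\<^sub>M restrict_space borel \<Theta>.
    \<exists>F \<in> sets (seq_space (restrict_space borel X) \<Otimes>\<^sub>M restrict_space borel \<Theta>).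
      emeasure (joint_measure (restrict_space borel X) P prior) F = 1 \<and>
      (\<forall>(x, \<theta>) \<in> F. f x = \<theta>)"
proof -
  define A where "A = restrict_space borel X"
  define T where "T = restrict_space borel \<Theta>"
  note sets_P = sets_P[folded A_def] and sets_prior = sets_prior[folded T_def]
    and measurable_P = measurable_P[folded A_def T_def]
  have space_T: "space T = \<Theta>"
    by (simp add: T_def space_restrict_space)
  have space_prior: "space prior = \<Theta>"
    using sets_eq_imp_space_eq[OF sets_prior] space_T by simp
  interpret prior: prob_space prior by (rule prob_prior)
  obtain C :: "nat \<Rightarrow> 'a set" where "range C \<subseteq> sets A" and determining: "\<forall>M N. finite_measure M \<longrightarrow>
      sets M = sets A \<longrightarrow> sets N = sets A \<longrightarrow> (\<forall>k. emeasure M (C k) = emeasure N (C k)) \<longrightarrow> M = N"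
    using countable_measure_determining_class[of X, folded A_def] by blast
  then have C: "C k \<in> sets A" for k
    by blast
  (* Extending by a constant sequence makes g a Borel map on the whole Polish space that contains \<Theta>;
     likewise M below is the prior regarded as a measure there, so that inner regularity applies. *)
  define g where "g \<theta> = (if \<theta> \<in> \<Theta> then (\<lambda>k. measure (P \<theta>) (C k)) else (\<lambda>_. 0))" for \<theta>
  have "(\<lambda>\<theta> k. measure (P \<theta>) (C k)) \<in> borel_measurable T"
    by (intro measurable_coordinatewise_then_product measurable_P C)
  then have g_meas: "g \<in> borel_measurable borel"
    unfolding g_def T_def using \<Theta>_borel by (subst (asm) measurable_restrict_space_iff) auto
  have g_inj: "inj_on g \<Theta>"
  proof (rule inj_onI)
    fix \<theta> \<theta>' assume \<theta>: "\<theta> \<in> \<Theta>" "\<theta>' \<in> \<Theta>" and "g \<theta> = g \<theta>'"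
    then have "measure (P \<theta>) (C k) = measure (P \<theta>') (C k)" for k
      by (auto simp: g_def dest: fun_cong)
    then have "P \<theta> = P \<theta>'"
      using \<theta> by (intro determining[rule_format])
        (auto simp: sets_P prob_P prob_space.finite_measure finite_measure.emeasure_eq_measure)
    then show "\<theta> = \<theta>'"
      using identifiable \<theta> by blast
  qed
  define M where "M = distr prior borel (\<lambda>\<theta>. \<theta>)"
  have id_meas: "(\<lambda>\<theta>. \<theta>) \<in> prior \<rightarrow>\<^sub>M borel"
    unfolding measurable_cong_sets[OF sets_prior refl] T_def
    by (rule measurable_restrict_space1) simp
  have "finite_measure M"
    unfolding M_def by (intro prior.finite_measure_distr id_meas)
  moreover have "\<Theta> \<noteq> {}"
    using prior.not_empty space_prior by simp
  ultimately obtain S r where S: "S \<in> sets borel" "S \<subseteq> \<Theta>" "measure M (\<Theta> - S) = 0"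
    and r: "r \<in> borel_measurable borel" "range r \<subseteq> \<Theta>" "\<And>\<theta>. \<theta> \<in> S \<Longrightarrow> r (g \<theta>) = \<theta>"
    using injective_measurable_ae_inverse[OF _ _ g_meas \<Theta>_borel _ g_inj, of M]
    by (auto simp: M_def)
  have S_full: "AE \<theta> in prior. \<theta> \<in> S"
  proof -
    have "measure M (\<Theta> - S) = measure prior (\<Theta> - S)"
      unfolding M_def using S \<Theta>_borel space_prior
      by (subst measure_distr[OF id_meas]) (auto intro!: arg_cong[where f = "measure prior"])
    moreover have "\<Theta> - S \<in> sets prior"
      using S \<Theta>_borel unfolding sets_prior T_def by (auto simp: sets_restrict_space_iff)
    ultimately have "\<Theta> - S \<in> null_sets prior"
      using S(3) by (simp add: null_sets_def prior.emeasure_eq_measure)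
    then show ?thesis
      by (rule AE_I') (auto simp: space_prior)
  qed
  define h where "h x k = lim (\<lambda>n. (\<Sum>i<n. indicator (C k) (x i)) / real n)" for x :: "nat \<Rightarrow> 'a" and k
  have coord [measurable]: "(\<lambda>x. x i) \<in> seq_space A \<rightarrow>\<^sub>M A" for i
    unfolding seq_space_def by measurable
  have h_coord [measurable]: "(\<lambda>x. h x k) \<in> borel_measurable (seq_space A)" for k
  proof -
    have [measurable]: "C k \<in> sets A" by (rule C)
    show ?thesis
      unfolding h_def by (rule borel_measurable_lim_metric) measurable
  qed
  then have h_meas: "h \<in> borel_measurable (seq_space A)"
    by (rule measurable_coordinatewise_then_product)
  (* Agreement of h x with g \<theta> yields r (h x) = \<theta> only for \<theta> in S, where r inverts g. *)
  define F where "F = {z \<in> space (seq_space A \<Otimes>\<^sub>M T). snd z \<in> S \<and> (\<forall>k. h (fst z) k = g (snd z) k)}"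
  have F_sets: "F \<in> sets (seq_space A \<Otimes>\<^sub>M T)"
  proof -
    have T_borel: "(\<lambda>\<theta>. \<theta>) \<in> T \<rightarrow>\<^sub>M borel"
      unfolding T_def by (rule measurable_restrict_space1) simp
    have [measurable]: "snd \<in> seq_space A \<Otimes>\<^sub>M T \<rightarrow>\<^sub>M borel"
      by (rule measurable_compose[OF measurable_snd T_borel])
    have [measurable]: "(\<lambda>\<theta>. g \<theta> k) \<in> borel_measurable borel" for k
      using g_meas by (rule measurable_product_then_coordinatewise)
    note S(1) [measurable]
    show ?thesis
      unfolding F_def by measurable
  qed
  have section_full: "emeasure (seq_space (P \<theta>)) {x. (x, \<theta>) \<in> F} = 1" if \<theta>: "\<theta> \<in> S" for \<theta>
  proof -
    have "\<theta> \<in> \<Theta>" using \<theta> S(2) by blast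
    interpret P: prob_space "P \<theta>" by (rule prob_P) fact
    interpret PS: prob_space "seq_space (P \<theta>)"
      unfolding seq_space_def by (intro prob_space_PiM P.prob_space_axioms)
    have sets_PS: "sets (seq_space (P \<theta>)) = sets (seq_space A)"
      unfolding seq_space_def using sets_P[OF \<open>\<theta> \<in> \<Theta>\<close>] by (intro sets_PiM_cong) auto
    have "AE x in seq_space (P \<theta>). \<forall>k.
        (\<lambda>n. (\<Sum>i<n. indicator (C k) (x i)) / real n) \<longlonglongrightarrow> measure (P \<theta>) (C k)"
      using C sets_P[OF \<open>\<theta> \<in> \<Theta>\<close>] by (subst AE_all_countable) (auto intro: P.strong_law_event)
    moreover have "AE x in seq_space (P \<theta>). x \<in> space (seq_space A)"
      using sets_eq_imp_space_eq[OF sets_PS] by (auto intro: AE_I2)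
    ultimately have "AE x in seq_space (P \<theta>). x \<in> {x. (x, \<theta>) \<in> F}"
      by eventually_elim
        (use \<theta> \<open>\<theta> \<in> \<Theta>\<close> in \<open>auto simp: F_def h_def g_def space_pair_measure space_T intro: limI\<close>)
    moreover have "{x. (x, \<theta>) \<in> F} \<in> sets (seq_space (P \<theta>))"
      using sets_Pair2[OF F_sets, of \<theta>] by (simp add: sets_PS vimage_def)
    ultimately show ?thesis
      by (intro PS.emeasure_eq_1_AE)
  qed
  have "emeasure (joint_measure A P prior) F =
      (\<integral>\<^sup>+ \<theta>. emeasure (seq_space (P \<theta>)) {x. (x, \<theta>) \<in> F} \<partial>prior)"
  proof (rule emeasure_joint_measure)
    show "F \<in> sets (seq_space A \<Otimes>\<^sub>M prior)"
      using F_sets unfolding sets_pair_measure_cong[OF refl sets_prior] .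
    show "(\<lambda>\<theta>. measure (P \<theta>) Y) \<in> borel_measurable prior" if "Y \<in> sets A" for Y
      using measurable_P[OF that] by (simp add: measurable_cong_sets[OF sets_prior refl])
  qed (auto simp: space_prior prob_P sets_P)
  also have "\<dots> = (\<integral>\<^sup>+ \<theta>. 1 \<partial>prior)"
    using S_full by (intro nn_integral_cong_AE) (auto simp: section_full)
  also have "\<dots> = 1"
    by (simp add: prior.emeasure_space_1)
  finally have F_full: "emeasure (joint_measure A P prior) F = 1" .
  have "(\<lambda>x. r (h x)) \<in> seq_space A \<rightarrow>\<^sub>M T"
    unfolding T_def using r(2)
    by (intro measurable_restrict_space2 measurable_compose[OF h_meas r(1)]) auto
  moreover have "\<forall>(x, \<theta>) \<in> F. r (h x) = \<theta>"
  proof safe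
    fix x \<theta> assume "(x, \<theta>) \<in> F"
    then have "\<theta> \<in> S" "h x = g \<theta>"
      by (auto simp: F_def)
    then show "r (h x) = \<theta>"
      using r(3) by simp
  qed
  ultimately show ?thesis
    using F_sets F_full unfolding A_def T_def
    by (intro bexI[of _ "\<lambda>x. r (h x)"] bexI[of _ F] conjI)
qed

end
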